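(* Let $X$ be a weakly connected finite digraph (no loops, no parallel arcs) on $n$ vertices whose $A$-Laplacian $L=L(X)$ is normal. Let $f(\lambda)=\frac{|\lambda|^2}{2\,\mathrm{Re}(\lambda)}$ for nonzero eigenvalues $\lambda$ of $L$; let $\theta\neq 0$ be an eigenvalue of $L$ maximizing $f$ among nonzero eigenvalues of $L$, and $\nu\neq 0$ an eigenvalue of $L$ minimizing $f$ among nonzero eigenvalues of $L$. Let \[ g(\lambda)=\frac{\mathrm{Re}(\lambda)\,(f(\theta)-f(\lambda))}{\mathrm{Re}(\theta)-\mathrm{Re}(\lambda)} \] (defined for nonzero eigenvalues $\lambda$ with $\mathrm{Re}(\lambda)\ne\mathrm{Re}(\theta)$), and let $\mu$ be an eigenvalue of $L$ minimizing $g$ subject to $g(\mu)\ge 0$ among eigenvalues in the domain of $g$, if one exists, and $\mu=0$ (with $g(0):=0$) otherwise. Let $Y$ and $Z$ be disjoint sets of vertices of $X$ such that there is no arc from a vertex of $Z$ to a vertex of $Y$. Then \[ \frac{|Y|\,|Z|}{(n-|Y|)(n-|Z|)}\le\frac{|\alpha+\theta|^2}{\alpha^2}, \] where \[ \alpha=\begin{cases}-f(\theta)-f(\nu), & \text{if } \mathrm{Re}(\lambda)\ge\mathrm{Re}(\theta) \text{ for all eigenvalues } \lambda\notin\{0,\theta\} \text{ of } L;\\ -f(\theta)-g(\mu), & \text{otherwise.}\end{cases} \]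
   Context: $A(X)$ is the adjacency matrix, $\Delta^+(X)$ the diagonal matrix of out-degrees, and $L(X)=\Delta^+(X)-A(X)$ the $A$-Laplacian; normal means $LL^T=L^TL$. For such $L$ every nonzero eigenvalue has positive real part, so $f$ is well defined on nonzero eigenvalues. *)

theory Defs
  imports
    "Graph_Theory.Digraph_Component"
    "Jordan_Normal_Form.Spectral_Radius"
begin

text \<open>
  Rows and columns of the matrices of a digraph are indexed by the positions in a list \<open>vs\<close>
  that enumerates the vertex set without repetition.
\<close>

definition adjacency_mat :: "('a, 'b) pre_digraph \<Rightarrow> 'a list \<Rightarrow> real mat" where
  "adjacency_mat X vs =
     mat (length vs) (length vs) (\<lambda>(i, j). if vs ! i \<rightarrow>\<^bsub>X\<^esub> vs ! j then 1 else 0)"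

definition out_degree_mat :: "('a, 'b) pre_digraph \<Rightarrow> 'a list \<Rightarrow> real mat" where
  "out_degree_mat X vs = mat_diag (length vs) (\<lambda>i. real (out_degree X (vs ! i)))"

definition laplacian_mat :: "('a, 'b) pre_digraph \<Rightarrow> 'a list \<Rightarrow> real mat" where
  "laplacian_mat X vs = out_degree_mat X vs - adjacency_mat X vs"

definition normal_mat :: "real mat \<Rightarrow> bool" where
  "normal_mat M \<longleftrightarrow> M * transpose_mat M = transpose_mat M * M"

definition complex_spectrum :: "real mat \<Rightarrow> complex set" where
  "complex_spectrum M = spectrum (map_mat complex_of_real M)"

definition f_val :: "complex \<Rightarrow> real" where
  "f_val l = (cmod l)\<^sup>2 / (2 * Re l)"

definition g_val :: "complex \<Rightarrow> complex \<Rightarrow> real" where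
  "g_val \<theta> l = (if l = 0 then 0 else Re l * (f_val \<theta> - f_val l) / (Re \<theta> - Re l))"

text \<open>
  In the following, \<open>S\<close> is the set of eigenvalues of the Laplacian. The value \<open>g_val \<theta> 0 = 0\<close> is
  only a convention for the case that no minimizer exists; 0 itself does not belong to the
  domain on which the minimum is taken.
\<close>

definition g_dom :: "complex set \<Rightarrow> complex \<Rightarrow> complex set" where
  "g_dom S \<theta> = {l \<in> S. l \<noteq> 0 \<and> Re l \<noteq> Re \<theta>}"

definition g_minimizer :: "complex set \<Rightarrow> complex \<Rightarrow> complex \<Rightarrow> bool" where
  "g_minimizer S \<theta> \<mu> \<longleftrightarrow>
     (if \<exists>l \<in> g_dom S \<theta>. g_val \<theta> l \<ge> 0
      then is_arg_min (g_val \<theta>) (\<lambda>l. l \<in> g_dom S \<theta> \<and> g_val \<theta> l \<ge> 0) \<mu>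
      else \<mu> = 0)"

definition alpha :: "complex set \<Rightarrow> complex \<Rightarrow> complex \<Rightarrow> complex \<Rightarrow> real" where
  "alpha S \<theta> \<nu> \<mu> =
     (if \<forall>l \<in> S - {0, \<theta>}. Re l \<ge> Re \<theta>
      then - f_val \<theta> - f_val \<nu>
      else - f_val \<theta> - g_val \<theta> \<mu>)"

end

theory Submission
  imports Defs "HOL-Analysis.Convex"
begin

text \<open>
  A normal matrix with zero row sums also has zero column sums, so \<open>L + \<alpha>I\<close> acts on the
  orthogonal complement of the all-ones vector, where, by weak connectedness, only the nonzero
  eigenvalues of \<open>L\<close> occur. The value \<open>\<alpha>\<close> is chosen such that \<open>|\<alpha> + \<lambda>|\<close> is maximal at
  \<open>\<lambda> = \<theta>\<close>: since \<open>|\<alpha> + \<lambda>|\<^sup>2 = 2 Re \<lambda> (f(\<lambda>) + \<alpha>) + \<alpha>\<^sup>2\<close>, this says, with \<open>\<alpha> = -f(\<theta>) - t\<close>, that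
  \<open>t (Re \<theta> - Re \<lambda>) \<le> Re \<lambda> (f(\<theta>) - f(\<lambda>))\<close>. Hence the restriction of \<open>L + \<alpha>I\<close> has norm at most
  \<open>|\<alpha> + \<theta>|\<close>. As there is no arc from \<open>Z\<close> to \<open>Y\<close>, the bilinear form of \<open>L + \<alpha>I\<close> vanishes on the
  indicator vectors of \<open>Z\<close> and \<open>Y\<close>; splitting off their all-ones components and applying the
  Cauchy-Schwarz inequality gives the bound.
\<close>

unbundle no inner_syntax

subsection \<open>Norms of normal matrices\<close>

text \<open>Log-convexity makes the ratios of successive terms nondecreasing, so a first ratio
  \<open>q > 1\<close> would force growth at least like \<open>q ^ k\<close>, against the
  bound.\<close>

lemma log_convex_bounded_imp_decreasing:
  fixes a :: "nat \<Rightarrow> real"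
  assumes nonneg: "\<And>k. a k \<ge> 0"
    and conv: "\<And>k. (a (Suc k))\<^sup>2 \<le> a k * a (Suc (Suc k))"
    and bdd: "\<And>k. a k \<le> C"
  shows "a 1 \<le> a 0"
proof (rule ccontr)
  assume "\<not> a 1 \<le> a 0"
  then have gt: "a 0 < a 1" by simp
  have pos0: "a 0 > 0"
  proof (rule ccontr)
    assume "\<not> a 0 > 0"
    then have "a 0 = 0" using nonneg[of 0] by simp
    then show False using conv[of 0] gt by simp
  qed
  define q where "q = a 1 / a 0"
  have q: "q > 1" using gt pos0 by (simp add: q_def)
  have step: "a k > 0 \<and> q * a k \<le> a (Suc k)" for k
  proof (induction k)
    case 0
    then show ?case using pos0 by (simp add: q_def)
  next
    case (Suc k)
    have "0 < q * a k" using Suc q by simp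
    then have pos: "a (Suc k) > 0" using Suc by linarith
    have "a k * (q * a (Suc k)) \<le> (a (Suc k))\<^sup>2"
      using mult_right_mono[of "q * a k" "a (Suc k)" "a (Suc k)"] Suc pos
      by (simp add: power2_eq_square mult_ac)
    also have "\<dots> \<le> a k * a (Suc (Suc k))" by (rule conv)
    finally show ?case using Suc pos by (simp add: mult_le_cancel_left_pos)
  qed
  have "q ^ k * a 0 \<le> a k" for k
  proof (induction k)
    case (Suc k)
    have "q ^ Suc k * a 0 \<le> q * a k" using Suc q by (simp add: mult.assoc)
    then show ?case using step[of k] by linarith
  qed simp
  then have le: "q ^ k \<le> C / a 0" for k
    using bdd[of k] pos0 by (smt (verit) pos_le_divide_eq)
  obtain k where "C / a 0 < q ^ k" using real_arch_pow[OF q] by blast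
  with le[of k] show False by simp
qed

lemma scalar_prod_self_nonneg: "(x :: real vec) \<bullet> x \<ge> 0"
  by (simp add: scalar_prod_def sum_nonneg)

lemma scalar_prod_Cauchy_Schwarz:
  fixes x y :: "real vec"
  assumes "x \<in> carrier_vec n" "y \<in> carrier_vec n"
  shows "(x \<bullet> y)\<^sup>2 \<le> (x \<bullet> x) * (y \<bullet> y)"
  using Cauchy_Schwarz_ineq_sum[of "($) x" "($) y" "{0..<n}"] assms
  by (simp add: scalar_prod_def power2_eq_square)

lemma scalar_prod_mult_mat_vec_transpose:
  fixes A :: "real mat"
  assumes A: "A \<in> carrier_mat n n" and "x \<in> carrier_vec n" "y \<in> carrier_vec n"
  shows "(A *\<^sub>v x) \<bullet> y = x \<bullet> (A\<^sup>T *\<^sub>v y)"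
  using transpose_vec_mult_scalar[of "A\<^sup>T" n n y x] assms
  by (metis comm_scalar_prod mult_mat_vec_carrier transpose_carrier_mat transpose_transpose)

text \<open>Both sides are quadratic forms at \<open>x\<close>, of \<open>A * A\<^sup>T\<close> and
  \<open>A\<^sup>T * A\<close>, and these products agree.\<close>

lemma normal_mat_transpose_norm:
  assumes A: "A \<in> carrier_mat n n" and N: "normal_mat A" and x: "x \<in> carrier_vec n"
  shows "(A\<^sup>T *\<^sub>v x) \<bullet> (A\<^sup>T *\<^sub>v x) = (A *\<^sub>v x) \<bullet> (A *\<^sub>v x)"
proof -
  have At: "A\<^sup>T \<in> carrier_mat n n" using A by simp
  have "(A\<^sup>T *\<^sub>v x) \<bullet> (A\<^sup>T *\<^sub>v x) = x \<bullet> ((A * A\<^sup>T) *\<^sub>v x)"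
    using scalar_prod_mult_mat_vec_transpose[OF At x, of "A\<^sup>T *\<^sub>v x"] A At x by simp
  also have "\<dots> = x \<bullet> ((A\<^sup>T * A) *\<^sub>v x)"
    using N by (simp add: normal_mat_def)
  also have "\<dots> = (A *\<^sub>v x) \<bullet> (A *\<^sub>v x)"
    using scalar_prod_mult_mat_vec_transpose[OF A x, of "A *\<^sub>v x"] A At x by simp
  finally show ?thesis .
qed

text \<open>Cauchy-Schwarz for \<open>x\<close> and
  \<open>A\<^sup>T *\<^sub>v (A *\<^sub>v x)\<close>; normality then replaces the outer transpose by
  \<open>A\<close> without changing the norm.\<close>

lemma normal_mat_norm_log_convex:
  assumes A: "A \<in> carrier_mat n n" and N: "normal_mat A" and x: "x \<in> carrier_vec n"
  shows "((A *\<^sub>v x) \<bullet> (A *\<^sub>v x))\<^sup>2 \<le> (x \<bullet> x) * ((A *\<^sub>v (A *\<^sub>v x)) \<bullet> (A *\<^sub>v (A *\<^sub>v x)))"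
proof -
  have At: "A\<^sup>T \<in> carrier_mat n n" using A by simp
  have Ax: "A *\<^sub>v x \<in> carrier_vec n" using A x by simp
  have "((A *\<^sub>v x) \<bullet> (A *\<^sub>v x))\<^sup>2 = (x \<bullet> (A\<^sup>T *\<^sub>v (A *\<^sub>v x)))\<^sup>2"
    using scalar_prod_mult_mat_vec_transpose[OF A x Ax] by simp
  also have "\<dots> \<le> (x \<bullet> x) * ((A\<^sup>T *\<^sub>v (A *\<^sub>v x)) \<bullet> (A\<^sup>T *\<^sub>v (A *\<^sub>v x)))"
    using scalar_prod_Cauchy_Schwarz[OF x] At Ax by simp
  finally show ?thesis using normal_mat_transpose_norm[OF A N Ax] by simp
qed

text \<open>The quantifier order matters: \<open>C\<close> depends on \<open>x\<close> and the entry
  bound \<open>c\<close> alone, so one constant serves all powers of a matrix.\<close>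

lemma norm_bound_mult_mat_vec_bounded:
  fixes x :: "real vec"
  assumes x: "x \<in> carrier_vec n"
  shows "\<exists>C. \<forall>A \<in> carrier_mat n n. norm_bound (map_mat complex_of_real A) c \<longrightarrow>
    (A *\<^sub>v x) \<bullet> (A *\<^sub>v x) \<le> C"
proof (intro exI ballI impI)
  fix A :: "real mat"
  assume A: "A \<in> carrier_mat n n" and b: "norm_bound (map_mat complex_of_real A) c"
  let ?s = "\<Sum>j<n. c * \<bar>x $ j\<bar>"
  have ent: "\<bar>A $$ (i, j)\<bar> \<le> c" if "i < n" "j < n" for i j
  proof -
    have "cmod (map_mat complex_of_real A $$ (i, j)) \<le> c"
      using b that A by (auto simp: norm_bound_def)
    then show ?thesis using that A by simp
  qed
  have "\<bar>(A *\<^sub>v x) $ i\<bar> \<le> ?s" if "i < n" for i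
  proof -
    have "(A *\<^sub>v x) $ i = (\<Sum>j<n. A $$ (i, j) * x $ j)"
      using that A x by (simp add: scalar_prod_def atLeast0LessThan)
    also have "\<bar>\<dots>\<bar> \<le> (\<Sum>j<n. \<bar>A $$ (i, j) * x $ j\<bar>)" by (rule sum_abs)
    also have "\<dots> \<le> ?s"
      using ent[OF that] by (intro sum_mono) (simp add: abs_mult mult_right_mono)
    finally show ?thesis .
  qed
  then have "(A *\<^sub>v x) $ i * (A *\<^sub>v x) $ i \<le> ?s\<^sup>2" if "i < n" for i
    using that abs_le_square_iff[of "(A *\<^sub>v x) $ i" ?s]
    by (smt (verit) abs_ge_zero abs_of_nonneg power2_eq_square)
  then have "(\<Sum>i<n. (A *\<^sub>v x) $ i * (A *\<^sub>v x) $ i) \<le> (\<Sum>i<n. ?s\<^sup>2)"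
    by (intro sum_mono) simp
  then show "(A *\<^sub>v x) \<bullet> (A *\<^sub>v x) \<le> real n * ?s\<^sup>2"
    using A by (simp add: scalar_prod_def atLeast0LessThan)
qed

text \<open>
  Bounded powers turn the spectral radius bound into a norm bound: by normality
  \<open>|A\<^sup>k x|\<close> is log-convex in \<open>k\<close>, and a bounded log-convex sequence cannot increase.
  This replaces the spectral theorem.
\<close>

lemma normal_mat_contraction:
  assumes A: "A \<in> carrier_mat n n" and N: "normal_mat A"
    and spec: "\<And>k. k \<in> complex_spectrum A \<Longrightarrow> cmod k < 1"
    and x: "x \<in> carrier_vec n"
  shows "(A *\<^sub>v x) \<bullet> (A *\<^sub>v x) \<le> x \<bullet> x"
\<comment> \<open>In dimension 0 the spectrum is empty and the spectral radius is not
  attained.\<close>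
proof (cases "n = 0")
  case True
  then show ?thesis using A x by (simp add: scalar_prod_def)
next
  case False
  let ?A = "map_mat complex_of_real A"
  have cA: "?A \<in> carrier_mat n n" using A by simp
  have "spectral_radius ?A < 1"
    using spectral_radius_mem_max(1)[OF cA] False spec by (auto simp: complex_spectrum_def)
  \<comment> \<open>Strictness is essential: with spectral radius exactly 1, a general matrix may
    have Jordan blocks whose powers grow.\<close>
  then obtain c where c: "norm_bound (?A ^\<^sub>m k) c" for k
    using spectral_radius_jnf_norm_bound_less_1_upper_triangular[OF cA] by blast
  obtain C where C: "\<And>B. B \<in> carrier_mat n n \<Longrightarrow> norm_bound (map_mat complex_of_real B) c \<Longrightarrow>
      (B *\<^sub>v x) \<bullet> (B *\<^sub>v x) \<le> C"
    using norm_bound_mult_mat_vec_bounded[OF x] by blast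
  define y where "y k = (A ^\<^sub>m k) *\<^sub>v x" for k
  have pow: "A ^\<^sub>m k \<in> carrier_mat n n" for k using A by simp
  have pow_hom: "map_mat complex_of_real (A ^\<^sub>m k) = ?A ^\<^sub>m k" for k
    by (rule of_real_hom.mat_hom_pow[OF A])
  have y: "y k \<in> carrier_vec n" for k using mult_mat_vec_carrier[OF pow x] by (simp add: y_def)
  have y_Suc: "y (Suc k) = A *\<^sub>v y k" for k
  proof -
    \<comment> \<open>Matrix powers add the new factor on the right; the iteration needs it on the
      left.\<close>
    have "A ^\<^sub>m Suc k = A * A ^\<^sub>m k"
    proof (induction k)
      case (Suc k)
      then show ?case using assoc_mult_mat[OF A pow[of k] A] by simp
    qed (use A in simp)
    then show ?thesis using assoc_mult_mat_vec[OF A pow x] by (simp add: y_def)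
  qed
  have "y 1 \<bullet> y 1 \<le> y 0 \<bullet> y 0"
  proof (rule log_convex_bounded_imp_decreasing[where C = C])
    show "y k \<bullet> y k \<ge> 0" for k by (rule scalar_prod_self_nonneg)
    show "(y (Suc k) \<bullet> y (Suc k))\<^sup>2 \<le> (y k \<bullet> y k) * (y (Suc (Suc k)) \<bullet> y (Suc (Suc k)))" for k
      using normal_mat_norm_log_convex[OF A N y] by (simp add: y_Suc)
    show "y k \<bullet> y k \<le> C" for k
      using C[OF pow, of k] c[of k] pow_hom[of k]
      by (simp add: y_def)
  qed
  then show ?thesis using A x by (simp add: y_def)
qed

text \<open>The eigenvector equation is unfolded into coordinate sums, the form in which both the
  shift by \<open>\<alpha>\<close> and the Laplacian are evaluated later.\<close>

lemma complex_spectrumE: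
  assumes "k \<in> complex_spectrum A" and A: "A \<in> carrier_mat n n"
  obtains v where "v \<in> carrier_vec n" "v \<noteq> 0\<^sub>v n"
    "\<And>i. i < n \<Longrightarrow> (\<Sum>j<n. complex_of_real (A $$ (i, j)) * v $ j) = k * v $ i"
proof -
  obtain v where v: "v \<in> carrier_vec n" "v \<noteq> 0\<^sub>v n" "map_mat complex_of_real A *\<^sub>v v = k \<cdot>\<^sub>v v"
    using assms by (auto simp: complex_spectrum_def spectrum_def eigenvalue_def eigenvector_def)
  have "(\<Sum>j<n. complex_of_real (A $$ (i, j)) * v $ j) = k * v $ i" if "i < n" for i
    using arg_cong[OF v(3), of "\<lambda>w. w $ i"] v(1) A that
    by (simp add: scalar_prod_def atLeast0LessThan)
  with v that show ?thesis by blast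
qed

lemma complex_spectrumI:
  assumes A: "A \<in> carrier_mat n n" and v: "v \<in> carrier_vec n" "v \<noteq> 0\<^sub>v n"
    and eq: "\<And>i. i < n \<Longrightarrow> (\<Sum>j<n. complex_of_real (A $$ (i, j)) * v $ j) = k * v $ i"
  shows "k \<in> complex_spectrum A"
proof -
  have "map_mat complex_of_real A *\<^sub>v v = k \<cdot>\<^sub>v v"
    using A v eq by (intro eq_vecI) (auto simp: scalar_prod_def atLeast0LessThan)
  then show ?thesis using A v
    by (auto simp: complex_spectrum_def spectrum_def eigenvalue_def eigenvector_def)
qed

text \<open>For every \<open>r > c\<close> the scaled matrix \<open>A / r\<close> has its spectrum
  strictly inside the unit disc and is a contraction; then \<open>r\<close> tends to
  \<open>c\<close> from the right. This also covers \<open>c = 0\<close>.\<close>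

lemma normal_mat_norm_bound:
  assumes A: "A \<in> carrier_mat n n" and N: "normal_mat A"
    and spec: "\<And>k. k \<in> complex_spectrum A \<Longrightarrow> cmod k \<le> c" and c: "c \<ge> 0"
    and x: "x \<in> carrier_vec n"
  shows "(A *\<^sub>v x) \<bullet> (A *\<^sub>v x) \<le> c\<^sup>2 * (x \<bullet> x)"
proof -
  have bound: "(A *\<^sub>v x) \<bullet> (A *\<^sub>v x) \<le> r\<^sup>2 * (x \<bullet> x)" if r: "r > c" for r
  proof -
    have r0: "r > 0" using r c by simp
    define B where "B = (1 / r) \<cdot>\<^sub>m A"
    have B: "B \<in> carrier_mat n n" using A by (simp add: B_def)
    have BT: "B\<^sup>T = (1 / r) \<cdot>\<^sub>m A\<^sup>T" by (auto simp: B_def)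
    have smult_mult: "((1 / r) \<cdot>\<^sub>m M) * ((1 / r) \<cdot>\<^sub>m M') = (1 / r) \<cdot>\<^sub>m ((1 / r) \<cdot>\<^sub>m (M * M'))"
      if M: "M \<in> carrier_mat n n" "M' \<in> carrier_mat n n" for M M' :: "real mat"
      using mult_smult_assoc_mat[OF M(1), of "(1 / r) \<cdot>\<^sub>m M'" n] mult_smult_distrib[OF M] M
      by simp
    have NB: "normal_mat B"
      using N A smult_mult[of A "A\<^sup>T"] smult_mult[of "A\<^sup>T" A]
      unfolding normal_mat_def BT unfolding B_def by simp
    have "cmod k < 1" if k: "k \<in> complex_spectrum B" for k
    proof -
      obtain v where v: "v \<in> carrier_vec n" "v \<noteq> 0\<^sub>v n"
        and eq: "\<And>i. i < n \<Longrightarrow> (\<Sum>j<n. complex_of_real (B $$ (i, j)) * v $ j) = k * v $ i"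
        using complex_spectrumE[OF k B] by blast
      have "(\<Sum>j<n. complex_of_real (A $$ (i, j)) * v $ j) = (r * k) * v $ i" if "i < n" for i
      proof -
        have "(\<Sum>j<n. complex_of_real (A $$ (i, j)) * v $ j)
            = (\<Sum>j<n. of_real r * (complex_of_real (B $$ (i, j)) * v $ j))"
          using A that r0 by (intro sum.cong) (auto simp: B_def)
        then show ?thesis using eq[OF that] by (simp add: sum_distrib_left[symmetric])
      qed
      then have "r * k \<in> complex_spectrum A" by (rule complex_spectrumI[OF A v])
      then have "r * cmod k \<le> c" using spec r0 by (fastforce simp: norm_mult)
      then have "r * cmod k < r * 1" using r by simp
      then show ?thesis using r0 by (simp only: mult_less_cancel_left_pos)
    qed
    then have "(B *\<^sub>v x) \<bullet> (B *\<^sub>v x) \<le> x \<bullet> x"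
      using normal_mat_contraction[OF B NB _ x] by blast
    moreover have "B *\<^sub>v x = (1 / r) \<cdot>\<^sub>v (A *\<^sub>v x)"
      using A x by (intro eq_vecI) (auto simp: B_def)
    ultimately show ?thesis using r0 A x
      by (simp add: field_simps power2_eq_square)
  qed
  show ?thesis
  proof (rule tendsto_le)
    show "((\<lambda>r. r\<^sup>2 * (x \<bullet> x)) \<longlongrightarrow> c\<^sup>2 * (x \<bullet> x)) (at_right c)"
      by (intro tendsto_intros)
    show "((\<lambda>r. (A *\<^sub>v x) \<bullet> (A *\<^sub>v x)) \<longlongrightarrow> (A *\<^sub>v x) \<bullet> (A *\<^sub>v x)) (at_right c)"
      by (rule tendsto_const)
    show "eventually (\<lambda>r. (A *\<^sub>v x) \<bullet> (A *\<^sub>v x) \<le> r\<^sup>2 * (x \<bullet> x)) (at_right c)"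
      using bound by (auto simp: eventually_at_filter)
  qed simp
qed

subsection \<open>Normal matrices with zero row sums\<close>

text \<open>The all-ones vector lies in the kernel of \<open>A\<close>, hence in that of
  \<open>A\<^sup>T\<close>, because the two images have the same norm.\<close>

lemma normal_mat_col_sums_zero:
  assumes A: "A \<in> carrier_mat n n" and N: "normal_mat A"
    and rows: "\<And>i. i < n \<Longrightarrow> (\<Sum>j<n. A $$ (i, j)) = 0" and j: "j < n"
  shows "(\<Sum>i<n. A $$ (i, j)) = 0"
proof -
  let ?e = "vec n (\<lambda>_. 1 :: real)"
  have "A *\<^sub>v ?e = 0\<^sub>v n"
    using A rows by (intro eq_vecI) (auto simp: scalar_prod_def atLeast0LessThan)
  then have "(A\<^sup>T *\<^sub>v ?e) \<bullet> (A\<^sup>T *\<^sub>v ?e) = 0"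
    using normal_mat_transpose_norm[OF A N, of ?e] by simp
  then have "(\<Sum>i<n. ((A\<^sup>T *\<^sub>v ?e) $ i)\<^sup>2) = 0"
    using A by (simp add: scalar_prod_def atLeast0LessThan power2_eq_square)
  then have "(A\<^sup>T *\<^sub>v ?e) $ j = 0" using j by (simp add: sum_nonneg_eq_0_iff)
  then show ?thesis using A j by (simp add: scalar_prod_def atLeast0LessThan)
qed

text \<open>
  On the orthogonal complement of the all-ones vector this is \<open>A + \<alpha>I\<close>, while the all-ones vector
  itself is mapped to 0 if \<open>A\<close> has zero row sums.
\<close>

definition shift_off_ones :: "real \<Rightarrow> nat \<Rightarrow> real mat \<Rightarrow> real mat" where
  "shift_off_ones \<alpha> n A =
     mat n n (\<lambda>(i, j). A $$ (i, j) + \<alpha> * ((if i = j then 1 else 0) - 1 / real n))"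

lemma shift_off_ones_carrier: "shift_off_ones \<alpha> n A \<in> carrier_mat n n"
  by (simp add: shift_off_ones_def)

text \<open>The field is left general because the identity is applied to real rows of matrices and
  to complex eigenvectors.\<close>

lemma shift_off_ones_mult:
  fixes w :: "nat \<Rightarrow> 'c :: real_normed_field"
  assumes "i < n"
  shows "(\<Sum>j<n. of_real (shift_off_ones \<alpha> n A $$ (i, j)) * w j)
    = (\<Sum>j<n. of_real (A $$ (i, j)) * w j) + of_real \<alpha> * (w i - (\<Sum>j<n. w j) / of_nat n)"
proof -
  have "(\<Sum>j<n. of_real (shift_off_ones \<alpha> n A $$ (i, j)) * w j)
    = (\<Sum>j<n. of_real (A $$ (i, j)) * w j + of_real \<alpha> * ((if i = j then w j else 0) - w j / of_nat n))"
    using assms by (intro sum.cong) (auto simp: shift_off_ones_def algebra_simps)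
  then show ?thesis using assms
    by (simp add: sum.distrib sum_subtractf sum_distrib_left[symmetric] sum_divide_distrib[symmetric])
qed

lemma shift_off_ones_transpose:
  "A \<in> carrier_mat n n \<Longrightarrow> (shift_off_ones \<alpha> n A)\<^sup>T = shift_off_ones \<alpha> n A\<^sup>T"
  by (auto simp: shift_off_ones_def)

lemma shift_off_ones_row_sum:
  assumes "i < n" "(\<Sum>j<n. A $$ (i, j)) = 0"
  shows "(\<Sum>j<n. shift_off_ones \<alpha> n A $$ (i, j)) = 0"
  using shift_off_ones_mult[OF assms(1), of \<alpha> A "\<lambda>_. 1 :: real"] assms by simp

lemma shift_off_ones_col_sum:
  assumes A: "A \<in> carrier_mat n n" and j: "j < n" and col: "(\<Sum>i<n. A $$ (i, j)) = 0"
  shows "(\<Sum>i<n. shift_off_ones \<alpha> n A $$ (i, j)) = 0"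
proof -
  have "(\<Sum>i<n. shift_off_ones \<alpha> n A\<^sup>T $$ (j, i)) = 0"
    using col A j by (intro shift_off_ones_row_sum) auto
  then show ?thesis using A j shift_off_ones_carrier[of \<alpha> n A]
    by (simp add: shift_off_ones_transpose[symmetric])
qed

text \<open>Write \<open>B = A + \<alpha> P\<close>, with \<open>P\<close> the projection off the
  all-ones vector. Zero row sums give \<open>A P = A\<close> and \<open>B P = B\<close>, so
  expanding one factor at a time leaves no \<open>P\<close> behind.\<close>

lemma shift_off_ones_mult_transpose:
  assumes A: "A \<in> carrier_mat n n" and rows: "\<And>i. i < n \<Longrightarrow> (\<Sum>j<n. A $$ (i, j)) = 0"
    and ij: "i < n" "j < n"
  shows "(shift_off_ones \<alpha> n A * (shift_off_ones \<alpha> n A)\<^sup>T) $$ (i, j)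
    = (A * A\<^sup>T) $$ (i, j) + \<alpha> * A $$ (i, j) + \<alpha> * shift_off_ones \<alpha> n A $$ (j, i)"
    (is "?l = ?r")
proof -
  let ?B = "shift_off_ones \<alpha> n A"
  have "?l = (\<Sum>k<n. ?B $$ (i, k) * ?B $$ (j, k))"
    using ij shift_off_ones_carrier[of \<alpha> n A] by (simp add: scalar_prod_def atLeast0LessThan)
  also have "\<dots> = (\<Sum>k<n. A $$ (i, k) * ?B $$ (j, k)) + \<alpha> * ?B $$ (j, i)"
    using shift_off_ones_mult[OF ij(1), of \<alpha> A "\<lambda>k. ?B $$ (j, k)"]
      shift_off_ones_row_sum[OF ij(2) rows[OF ij(2)]] by simp
  also have "(\<Sum>k<n. A $$ (i, k) * ?B $$ (j, k)) = (\<Sum>k<n. A $$ (j, k) * A $$ (i, k)) + \<alpha> * A $$ (i, j)"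
    using shift_off_ones_mult[OF ij(2), of \<alpha> A "\<lambda>k. A $$ (i, k)"] rows[OF ij(1)]
    by (simp add: mult.commute)
  also have "(\<Sum>k<n. A $$ (j, k) * A $$ (i, k)) = (A * A\<^sup>T) $$ (i, j)"
    using ij A by (simp add: scalar_prod_def atLeast0LessThan mult.commute)
  finally show ?thesis by simp
qed

text \<open>Apply the preceding expansion to \<open>A\<close> and to \<open>A\<^sup>T\<close>: the
  two correction terms agree, both being
  \<open>\<alpha> (A + A\<^sup>T) + \<alpha>\<^sup>2 P\<close>.\<close>

lemma normal_mat_shift_off_ones:
  assumes A: "A \<in> carrier_mat n n" and N: "normal_mat A"
    and rows: "\<And>i. i < n \<Longrightarrow> (\<Sum>j<n. A $$ (i, j)) = 0"
  shows "normal_mat (shift_off_ones \<alpha> n A)"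
  unfolding normal_mat_def
proof (rule eq_matI)
  let ?B = "shift_off_ones \<alpha> n A"
  have B: "?B \<in> carrier_mat n n" by (rule shift_off_ones_carrier)
  have At: "A\<^sup>T \<in> carrier_mat n n" using A by simp
  have rowst: "(\<Sum>j<n. A\<^sup>T $$ (i, j)) = 0" if "i < n" for i
    using normal_mat_col_sums_zero[OF A N rows that] A that by simp
  fix i j assume "i < dim_row (?B\<^sup>T * ?B)" "j < dim_col (?B\<^sup>T * ?B)"
  then have ij: "i < n" "j < n" using B by auto
  have "(?B\<^sup>T * ?B) $$ (i, j) = (A\<^sup>T * A) $$ (i, j) + \<alpha> * A $$ (j, i) + \<alpha> * ?B\<^sup>T $$ (j, i)"
    using shift_off_ones_mult_transpose[OF At rowst ij] A ij
    by (simp add: shift_off_ones_transpose[symmetric])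
  moreover have "\<alpha> * A $$ (i, j) + \<alpha> * ?B $$ (j, i) = \<alpha> * A $$ (j, i) + \<alpha> * ?B\<^sup>T $$ (j, i)"
    using ij by (simp add: shift_off_ones_def algebra_simps)
  ultimately show "(?B * ?B\<^sup>T) $$ (i, j) = (?B\<^sup>T * ?B) $$ (i, j)"
    using shift_off_ones_mult_transpose[OF A rows ij] N by (simp add: normal_mat_def)
qed (auto simp: shift_off_ones_def)

text \<open>Summing the eigenvector equation over all rows gives \<open>k\<close> times the
  coordinate sum on one side and, by the column sums, 0 on the other. For \<open>k = 0\<close> this
  says nothing, and the eigenvector may be the all-ones vector.\<close>

lemma shift_off_ones_spectrumE:
  assumes A: "A \<in> carrier_mat n n"
    and cols: "\<And>j. j < n \<Longrightarrow> (\<Sum>i<n. A $$ (i, j)) = 0"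
    and k: "k \<in> complex_spectrum (shift_off_ones \<alpha> n A)" "k \<noteq> 0"
  obtains v where "v \<in> carrier_vec n" "v \<noteq> 0\<^sub>v n" "(\<Sum>j<n. v $ j) = 0"
    "\<And>i. i < n \<Longrightarrow> (\<Sum>j<n. complex_of_real (A $$ (i, j)) * v $ j) = (k - of_real \<alpha>) * v $ i"
proof -
  let ?B = "shift_off_ones \<alpha> n A"
  obtain v where v: "v \<in> carrier_vec n" "v \<noteq> 0\<^sub>v n"
    and eq: "\<And>i. i < n \<Longrightarrow> (\<Sum>j<n. complex_of_real (?B $$ (i, j)) * v $ j) = k * v $ i"
    using complex_spectrumE[OF k(1) shift_off_ones_carrier] by blast
  have colsB: "(\<Sum>i<n. ?B $$ (i, j)) = 0" if "j < n" for j
    by (rule shift_off_ones_col_sum[OF A that cols[OF that]])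
  have "k * (\<Sum>i<n. v $ i) = (\<Sum>i<n. \<Sum>j<n. complex_of_real (?B $$ (i, j)) * v $ j)"
    using eq by (simp add: sum_distrib_left)
  also have "\<dots> = (\<Sum>j<n. complex_of_real (\<Sum>i<n. ?B $$ (i, j)) * v $ j)"
    by (subst sum.swap) (simp add: sum_distrib_right)
  also have "\<dots> = 0" using colsB by simp
  finally have sum0: "(\<Sum>j<n. v $ j) = 0" using k(2) by simp
  have "(\<Sum>j<n. complex_of_real (A $$ (i, j)) * v $ j) = (k - of_real \<alpha>) * v $ i" if "i < n" for i
    using shift_off_ones_mult[OF that, of \<alpha> A "($) v"] eq[OF that] sum0
    by (simp add: algebra_simps)
  with v sum0 that show ?thesis by blast
qed

section \<open>Indicator vectors projected off the all-ones vector, and the separation bound\<close>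

definition centered_indicator :: "nat \<Rightarrow> nat set \<Rightarrow> real vec" where
  "centered_indicator n Y = vec n (\<lambda>i. of_bool (i \<in> Y) - real (card Y) / real n)"

text \<open>A vector with zero sum does not see the subtracted constant.\<close>

lemma sum_mult_centered_indicator:
  assumes "Y \<subseteq> {..<n}" and "(\<Sum>j<n. w j) = 0"
  shows "(\<Sum>j<n. w j * centered_indicator n Y $ j) = sum w Y"
proof -
  have "(\<Sum>j<n. w j * centered_indicator n Y $ j)
      = (\<Sum>j<n. w j * of_bool (j \<in> Y) - w j * (real (card Y) / real n))"
    by (intro sum.cong) (auto simp: centered_indicator_def right_diff_distrib)
  also have "\<dots> = (\<Sum>j<n. w j * of_bool (j \<in> Y))"
    using assms(2) by (simp add: sum_subtractf flip: sum_distrib_right sum_divide_distrib)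
  also have "\<dots> = sum w Y"
    using assms(1) by (simp add: sum_mult_of_bool_eq Int_absorb1)
  finally show ?thesis .
qed

lemma centered_indicator_norm:
  assumes Y: "Y \<subseteq> {..<n}" and n: "n > 0"
  shows "centered_indicator n Y \<bullet> centered_indicator n Y = real (card Y) * (real n - real (card Y)) / real n"
proof -
  have zero: "(\<Sum>j<n. centered_indicator n Y $ j) = 0"
    using Y n by (simp add: centered_indicator_def sum_subtractf Int_absorb1)
  have "centered_indicator n Y \<bullet> centered_indicator n Y = (\<Sum>j\<in>Y. centered_indicator n Y $ j)"
    using sum_mult_centered_indicator[OF Y zero]
    by (simp add: scalar_prod_def atLeast0LessThan centered_indicator_def)
  also have "\<dots> = (\<Sum>j\<in>Y. 1 - real (card Y) / real n)"
    using Y by (intro sum.cong) (auto simp: centered_indicator_def)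
  also have "\<dots> = real (card Y) * (real n - real (card Y)) / real n"
    using n by (simp add: field_simps)
  finally show ?thesis .
qed

text \<open>Only zero-sum eigenvectors enter \<open>spec\<close>: the all-ones vector, with
  eigenvalue 0, would demand that \<open>c\<close> be at least the modulus of
  \<open>\<alpha>\<close>. The conclusion is cross-multiplied to avoid zero denominators.\<close>

theorem normal_mat_separation_bound:
  assumes A: "A \<in> carrier_mat n n" and N: "normal_mat A"
    and rows: "\<And>i. i < n \<Longrightarrow> (\<Sum>j<n. A $$ (i, j)) = 0"
    and spec: "\<And>l v. \<lbrakk>v \<in> carrier_vec n; v \<noteq> 0\<^sub>v n; (\<Sum>j<n. v $ j) = 0;
        \<And>i. i < n \<Longrightarrow> (\<Sum>j<n. complex_of_real (A $$ (i, j)) * v $ j) = l * v $ i\<rbrakk>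
        \<Longrightarrow> cmod (of_real \<alpha> + l) \<le> c"
    and c: "c \<ge> 0"
    and Y: "Y \<subseteq> {..<n}" and Z: "Z \<subseteq> {..<n}" and disj: "Y \<inter> Z = {}"
    and sep: "\<And>i j. i \<in> Z \<Longrightarrow> j \<in> Y \<Longrightarrow> A $$ (i, j) = 0"
  shows "\<alpha>\<^sup>2 * (real (card Y) * real (card Z)) \<le> c\<^sup>2 * ((real n - real (card Y)) * (real n - real (card Z)))"
\<comment> \<open>The product of the cardinalities is cancelled at the end, so it must be positive
  there.\<close>
proof (cases "card Y = 0 \<or> card Z = 0")
  case True
  have "card Y \<le> n" "card Z \<le> n"
    using Y Z card_mono[of "{..<n}"] by fastforce+
  then have "0 \<le> c\<^sup>2 * ((real n - real (card Y)) * (real n - real (card Z)))" by simp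
  with True show ?thesis by auto
next
  case False
  then have pos: "real (card Y) * real (card Z) > 0" by simp
  have "Y \<noteq> {}" using False by auto
  then have n: "n > 0" using Y by auto
  let ?B = "shift_off_ones \<alpha> n A" and ?y = "centered_indicator n Y" and ?z = "centered_indicator n Z"
  have B: "?B \<in> carrier_mat n n" by (rule shift_off_ones_carrier)
  have y: "?y \<in> carrier_vec n" and z: "?z \<in> carrier_vec n"
    by (simp_all add: centered_indicator_def)
  have cols: "(\<Sum>i<n. A $$ (i, j)) = 0" if "j < n" for j
    by (rule normal_mat_col_sums_zero[OF A N rows that])
  have NB: "normal_mat ?B" by (rule normal_mat_shift_off_ones[OF A N rows])
  have specB: "cmod k \<le> c" if k: "k \<in> complex_spectrum ?B" for k
  proof (cases "k = 0")
    case False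
    obtain v where "v \<in> carrier_vec n" "v \<noteq> 0\<^sub>v n" "(\<Sum>j<n. v $ j) = 0"
      "\<And>i. i < n \<Longrightarrow> (\<Sum>j<n. complex_of_real (A $$ (i, j)) * v $ j) = (k - of_real \<alpha>) * v $ i"
      using shift_off_ones_spectrumE[OF A cols k False] by blast
    from spec[OF this] show ?thesis by simp
  qed (use c in simp)
  have bound: "(?B *\<^sub>v ?y) \<bullet> (?B *\<^sub>v ?y) \<le> c\<^sup>2 * (?y \<bullet> ?y)"
    by (rule normal_mat_norm_bound[OF B NB specB c y])
  have By: "(?B *\<^sub>v ?y) $ i = (\<Sum>j\<in>Y. ?B $$ (i, j))" if i: "i < n" for i
    using sum_mult_centered_indicator[OF Y shift_off_ones_row_sum[OF i rows[OF i]], of \<alpha>] B i y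
    by (simp add: scalar_prod_def atLeast0LessThan)
  have colsB: "(\<Sum>i<n. ?B $$ (i, j)) = 0" if "j < n" for j
    by (rule shift_off_ones_col_sum[OF A that cols[OF that]])
  have "(\<Sum>i<n. (?B *\<^sub>v ?y) $ i) = (\<Sum>j\<in>Y. \<Sum>i<n. ?B $$ (i, j))"
    by (subst sum.swap) (simp add: By del: index_mult_mat_vec)
  also have "\<dots> = 0" using colsB Y by (intro sum.neutral) auto
  finally have "(\<Sum>i<n. (?B *\<^sub>v ?y) $ i * ?z $ i) = (\<Sum>i\<in>Z. (?B *\<^sub>v ?y) $ i)"
    by (rule sum_mult_centered_indicator[OF Z])
  also have "\<dots> = (\<Sum>i\<in>Z. \<Sum>j\<in>Y. ?B $$ (i, j))"
    using Z by (intro sum.cong) (auto simp del: index_mult_mat_vec simp: By)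
  \<comment> \<open>Off the diagonal and where \<open>A\<close> vanishes, only the all-ones part of
    the projection is left.\<close>
  also have "\<dots> = (\<Sum>i\<in>Z. \<Sum>j\<in>Y. - \<alpha> / real n)"
  proof (intro sum.cong refl)
    fix i j assume "i \<in> Z" "j \<in> Y"
    moreover from this have "i \<noteq> j" "i < n" "j < n" using disj Y Z by auto
    ultimately show "?B $$ (i, j) = - \<alpha> / real n" using sep by (simp add: shift_off_ones_def)
  qed
  also have "\<dots> = - \<alpha> * (real (card Y) * real (card Z)) / real n" by simp
  finally have prod: "?z \<bullet> (?B *\<^sub>v ?y) = - \<alpha> * (real (card Y) * real (card Z)) / real n"
    using B z by (simp add: scalar_prod_def atLeast0LessThan mult.commute del: index_mult_mat_vec)
  have "(?z \<bullet> (?B *\<^sub>v ?y))\<^sup>2 \<le> (?z \<bullet> ?z) * ((?B *\<^sub>v ?y) \<bullet> (?B *\<^sub>v ?y))"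
    by (rule scalar_prod_Cauchy_Schwarz[OF z mult_mat_vec_carrier[OF B y]])
  also have "\<dots> \<le> (?z \<bullet> ?z) * (c\<^sup>2 * (?y \<bullet> ?y))"
    by (rule mult_left_mono[OF bound scalar_prod_self_nonneg])
  \<comment> \<open>Squaring the bilinear form yields the product of cardinalities twice, the two
    norms yield it once; the factors of \<open>n\<close> cancel.\<close>
  finally have "(real (card Y) * real (card Z)) * (\<alpha>\<^sup>2 * (real (card Y) * real (card Z)))
      \<le> (real (card Y) * real (card Z)) * (c\<^sup>2 * ((real n - real (card Y)) * (real n - real (card Z))))"
    unfolding prod centered_indicator_norm[OF Y n] centered_indicator_norm[OF Z n] using n
    by (simp add: power2_eq_square divide_le_cancel mult_ac)
  then show ?thesis using pos by (simp only: mult_le_cancel_left_pos)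
qed

subsection \<open>Laplacians of digraphs\<close>

text \<open>The degree counts arcs, the matrix row counts heads; the absence of parallel arcs makes
  \<open>head X\<close> injective on the arcs leaving a vertex.\<close>

lemma sum_adjacency_eq_out_degree:
  assumes "digraph X" and "set vs = verts X" and "distinct vs" and i: "i < length vs"
  shows "(\<Sum>j<length vs. if vs ! i \<rightarrow>\<^bsub>X\<^esub> vs ! j then 1 else (0::real)) = real (out_degree X (vs ! i))"
proof -
  interpret digraph X by fact
  let ?J = "{j. j < length vs \<and> vs ! i \<rightarrow>\<^bsub>X\<^esub> vs ! j}"
  have "bij_betw ((!) vs) {..<length vs} (verts X)"
    using bij_betw_nth[OF assms(3) refl assms(2)[symmetric]] .
  then have inj: "inj_on ((!) vs) ?J"
    by (auto simp: bij_betw_def inj_on_def)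
  have "u \<in> (!) vs ` ?J" if "vs ! i \<rightarrow>\<^bsub>X\<^esub> u" for u
  proof -
    have "u \<in> set vs" using adj_in_verts(2)[OF that] assms(2) by simp
    then obtain j where "j < length vs" "u = vs ! j" by (auto simp: in_set_conv_nth)
    then show ?thesis using that by blast
  qed
  then have img: "(!) vs ` ?J = {u. vs ! i \<rightarrow>\<^bsub>X\<^esub> u}" by blast
  have card_J: "card ?J = card {u. vs ! i \<rightarrow>\<^bsub>X\<^esub> u}"
    using card_image[OF inj] unfolding img by simp
  have inj_head: "inj_on (head X) (out_arcs X (vs ! i))"
    by (rule inj_onI, rule no_multi_arcs) (auto simp: out_arcs_def arc_to_ends_def)
  have head_img: "head X ` out_arcs X (vs ! i) = {u. vs ! i \<rightarrow>\<^bsub>X\<^esub> u}"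
    by (force simp: out_arcs_def arcs_ends_def arc_to_ends_def image_iff)
  have "card {u. vs ! i \<rightarrow>\<^bsub>X\<^esub> u} = out_degree X (vs ! i)"
    using card_image[OF inj_head] unfolding head_img by (simp add: out_degree_def)
  with card_J show ?thesis by (simp add: sum.If_cases Collect_conj_eq lessThan_def)
qed

text \<open>Weak connectedness is reachability in the symmetric closure, each step of which is an
  arc of \<open>X\<close> in one of the two directions.\<close>

lemma connected_arc_invariant_imp_constant:
  assumes "digraph X" and conn: "Digraph_Component.connected X"
    and inv: "\<And>u w. u \<rightarrow>\<^bsub>X\<^esub> w \<Longrightarrow> h u = h w"
    and "u \<in> verts X" "w \<in> verts X"
  shows "h u = h w"
proof -
  interpret digraph X by fact
  have "u \<rightarrow>\<^sup>*\<^bsub>mk_symmetric X\<^esub> w"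
    using conn assms(4,5) by (auto simp: connected_def strongly_connected_def)
  then have "(u, w) \<in> rtrancl_on (verts X) (parcs (mk_symmetric X))"
    by (simp add: reachable_def)
  then show ?thesis
  proof (induction rule: rtrancl_on_induct)
    case (step w w')
    have "w \<rightarrow>\<^bsub>X\<^esub> w' \<or> w' \<rightarrow>\<^bsub>X\<^esub> w"
      using step by (auto simp: parcs_mk_symmetric arcs_ends_def arc_to_ends_def)
    then show ?case using inv step.IH by metis
  qed simp
qed

text \<open>Pair the eigenvector equation with the conjugate of \<open>v\<close> and take real
  parts. By polarization each term is a squared difference plus
  \<open>(cmod (v i))\<^sup>2 - (cmod (v j))\<^sup>2\<close>, and the latter cancel in total because
  the weights are balanced.\<close>

lemma weighted_laplacian_energy:
  fixes a :: "nat \<Rightarrow> nat \<Rightarrow> real" and v :: "nat \<Rightarrow> complex"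
  assumes bal: "\<And>j. j < n \<Longrightarrow> (\<Sum>i<n. a i j) = (\<Sum>i<n. a j i)"
    and eig: "\<And>i. i < n \<Longrightarrow> (\<Sum>j<n. complex_of_real (a i j) * (v i - v j)) = l * v i"
  shows "2 * Re l * (\<Sum>i<n. (cmod (v i))\<^sup>2) = (\<Sum>i<n. \<Sum>j<n. a i j * (cmod (v i - v j))\<^sup>2)"
proof -
  have "l * (\<Sum>i<n. complex_of_real ((cmod (v i))\<^sup>2)) = (\<Sum>i<n. (l * v i) * cnj (v i))"
    by (simp only: sum_distrib_left mult.assoc complex_norm_square)
  also have "\<dots> = (\<Sum>i<n. \<Sum>j<n. of_real (a i j) * ((v i - v j) * cnj (v i)))"
    by (intro sum.cong refl) (simp only: lessThan_iff eig[symmetric] sum_distrib_right mult.assoc)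
  finally have "Re (l * of_real (\<Sum>i<n. (cmod (v i))\<^sup>2))
      = Re (\<Sum>i<n. \<Sum>j<n. of_real (a i j) * ((v i - v j) * cnj (v i)))"
    by simp
  then have *: "Re l * (\<Sum>i<n. (cmod (v i))\<^sup>2) = (\<Sum>i<n. \<Sum>j<n. a i j * Re ((v i - v j) * cnj (v i)))"
    by simp
  have pt: "2 * Re ((v i - v j) * cnj (v i)) = (cmod (v i - v j))\<^sup>2 + (cmod (v i))\<^sup>2 - (cmod (v j))\<^sup>2" for i j
    unfolding cmod_power2 by (simp add: power2_eq_square algebra_simps)
  have "2 * Re l * (\<Sum>i<n. (cmod (v i))\<^sup>2) = (\<Sum>i<n. \<Sum>j<n. a i j * (2 * Re ((v i - v j) * cnj (v i))))"
    unfolding mult.assoc * by (simp only: sum_distrib_left mult.left_commute[of "a _ _" 2])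
  also have "\<dots> = (\<Sum>i<n. \<Sum>j<n. a i j * (cmod (v i - v j))\<^sup>2)
      + ((\<Sum>i<n. \<Sum>j<n. a i j * (cmod (v i))\<^sup>2) - (\<Sum>i<n. \<Sum>j<n. a i j * (cmod (v j))\<^sup>2))"
    unfolding pt by (simp add: algebra_simps sum.distrib sum_subtractf)
  also have "(\<Sum>i<n. \<Sum>j<n. a i j * (cmod (v j))\<^sup>2) = (\<Sum>j<n. (\<Sum>i<n. a i j) * (cmod (v j))\<^sup>2)"
    by (subst sum.swap) (simp add: sum_distrib_right)
  also have "\<dots> = (\<Sum>i<n. \<Sum>j<n. a i j * (cmod (v i))\<^sup>2)"
    using bal by (simp add: sum_distrib_right)
  finally show ?thesis by simp
qed

section \<open>The Laplacian matrix and its eigenvectors\<close>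

lemma laplacian_mat_carrier: "laplacian_mat X vs \<in> carrier_mat (length vs) (length vs)"
  by (auto simp: laplacian_mat_def adjacency_mat_def out_degree_mat_def mat_diag_def)

lemma laplacian_mat_index:
  assumes "i < length vs" "j < length vs"
  shows "laplacian_mat X vs $$ (i, j)
    = (if i = j then real (out_degree X (vs ! i)) else 0) - (if vs ! i \<rightarrow>\<^bsub>X\<^esub> vs ! j then 1 else 0)"
  using assms by (simp add: laplacian_mat_def adjacency_mat_def out_degree_mat_def mat_diag_def)

lemma laplacian_mat_mult:
  fixes w :: "nat \<Rightarrow> 'c :: real_normed_field"
  assumes "digraph X" and "set vs = verts X" and "distinct vs" and i: "i < length vs"
  shows "(\<Sum>j<length vs. of_real (laplacian_mat X vs $$ (i, j)) * w j)
    = (\<Sum>j<length vs. of_real (if vs ! i \<rightarrow>\<^bsub>X\<^esub> vs ! j then 1 else 0) * (w i - w j))"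
proof -
  let ?a = "\<lambda>j. if vs ! i \<rightarrow>\<^bsub>X\<^esub> vs ! j then 1 else (0 :: real)"
  have "(\<Sum>j<length vs. of_real (laplacian_mat X vs $$ (i, j)) * w j)
      = (\<Sum>j<length vs. (if i = j then of_real (real (out_degree X (vs ! i))) * w j else 0) - of_real (?a j) * w j)"
    using i by (intro sum.cong) (auto simp: laplacian_mat_index left_diff_distrib)
  also have "\<dots> = of_real (\<Sum>j<length vs. ?a j) * w i - (\<Sum>j<length vs. of_real (?a j) * w j)"
    unfolding sum_adjacency_eq_out_degree[OF assms] using i by (simp add: sum_subtractf)
  also have "\<dots> = (\<Sum>j<length vs. of_real (?a j) * (w i - w j))"
    by (simp only: of_real_sum sum_distrib_right right_diff_distrib sum_subtractf)
  finally show ?thesis .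
qed

lemma laplacian_mat_row_sum:
  assumes "digraph X" and "set vs = verts X" and "distinct vs" and "i < length vs"
  shows "(\<Sum>j<length vs. laplacian_mat X vs $$ (i, j)) = 0"
  using laplacian_mat_mult[OF assms, of "\<lambda>_. 1 :: real"] by simp

text \<open>
  A normal Laplacian has equal in- and out-degrees, so the real part of its Hermitian form is
  \<open>\<Sum> a\<^sub>i\<^sub>j |v\<^sub>i - v\<^sub>j|\<^sup>2 / 2\<close>; it vanishes only for vectors that are constant along arcs.
\<close>

lemma normal_laplacian_eigenvector_constant:
  assumes X: "digraph X" and conn: "Digraph_Component.connected X"
    and vs: "set vs = verts X" "distinct vs"
    and N: "normal_mat (laplacian_mat X vs)"
    and eig: "\<And>i. i < length vs \<Longrightarrow>
      (\<Sum>j<length vs. complex_of_real (laplacian_mat X vs $$ (i, j)) * v j) = l * v i"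
    and l: "Re l \<le> 0" and ij: "i < length vs" "j < length vs"
  shows "v i = v j"
proof -
  let ?n = "length vs" and ?L = "laplacian_mat X vs"
  define a :: "nat \<Rightarrow> nat \<Rightarrow> real" where "a i j = (if vs ! i \<rightarrow>\<^bsub>X\<^esub> vs ! j then 1 else 0)" for i j
  have eig': "(\<Sum>j<?n. complex_of_real (a i j) * (v i - v j)) = l * v i" if "i < ?n" for i
    using laplacian_mat_mult[OF X vs that, of v] eig[OF that] by (simp add: a_def)
  have bal: "(\<Sum>i<?n. a i j) = (\<Sum>i<?n. a j i)" if j: "j < ?n" for j
  proof -
    have "0 = (\<Sum>i<?n. ?L $$ (i, j))"
      using normal_mat_col_sums_zero[OF laplacian_mat_carrier N laplacian_mat_row_sum[OF X vs] j] by simp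
    also have "\<dots> = (\<Sum>i<?n. (if i = j then real (out_degree X (vs ! i)) else 0) - a i j)"
      using j by (intro sum.cong) (auto simp: laplacian_mat_index a_def)
    also have "\<dots> = real (out_degree X (vs ! j)) - (\<Sum>i<?n. a i j)"
      using j by (simp add: sum_subtractf)
    finally show ?thesis
      using sum_adjacency_eq_out_degree[OF X vs j] by (simp add: a_def)
  qed
  have "(\<Sum>i<?n. \<Sum>j<?n. a i j * (cmod (v i - v j))\<^sup>2) = 2 * Re l * (\<Sum>i<?n. (cmod (v i))\<^sup>2)"
    using weighted_laplacian_energy[OF bal eig'] by simp
  also have "\<dots> \<le> 0"
    using l by (simp add: mult_nonpos_nonneg sum_nonneg)
  finally have le: "(\<Sum>i<?n. \<Sum>j<?n. a i j * (cmod (v i - v j))\<^sup>2) \<le> 0" .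
  have nn: "0 \<le> a i j * (cmod (v i - v j))\<^sup>2" for i j by (simp add: a_def)
  have "(\<Sum>i<?n. \<Sum>j<?n. a i j * (cmod (v i - v j))\<^sup>2) = 0"
    using le nn by (intro antisym sum_nonneg) auto
  then have zero: "a i j * (cmod (v i - v j))\<^sup>2 = 0" if "i < ?n" "j < ?n" for i j
    using nn that by (simp add: sum_nonneg_eq_0_iff sum_nonneg)
  \<comment> \<open>Connectedness speaks of vertices, so \<open>v\<close> is carried over from
    positions; the position is unique since \<open>vs\<close> is distinct.\<close>
  define h where "h u = v (THE i. i < ?n \<and> vs ! i = u)" for u
  have h: "h (vs ! i) = v i" if "i < ?n" for i
  proof -
    have "(THE k. k < ?n \<and> vs ! k = vs ! i) = i"
      using that vs(2) by (intro the_equality) (auto simp: nth_eq_iff_index_eq)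
    then show ?thesis by (simp add: h_def)
  qed
  have "h u = h w" if uw: "u \<rightarrow>\<^bsub>X\<^esub> w" for u w
  proof -
    interpret digraph X by fact
    have "u \<in> set vs" "w \<in> set vs" using uw vs(1) adj_in_verts by auto
    then obtain p q where pq: "p < ?n" "u = vs ! p" "q < ?n" "w = vs ! q"
      by (auto simp: in_set_conv_nth)
    then have "v p = v q" using zero[of p q] uw by (simp add: a_def)
    then show ?thesis using pq h by simp
  qed
  then have "h (vs ! i) = h (vs ! j)"
    using connected_arc_invariant_imp_constant[OF X conn, of h] ij vs(1) nth_mem by metis
  then show ?thesis using h ij by simp
qed

text \<open>Otherwise the eigenvector would be constant, and constants belong to the eigenvalue 0
  because the row sums vanish.\<close>

lemma normal_laplacian_Re_pos:
  assumes X: "digraph X" and conn: "Digraph_Component.connected X"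
    and vs: "set vs = verts X" "distinct vs"
    and N: "normal_mat (laplacian_mat X vs)"
    and l: "l \<in> complex_spectrum (laplacian_mat X vs)" "l \<noteq> 0"
  shows "Re l > 0"
proof (rule ccontr)
  assume neg: "\<not> Re l > 0"
  let ?n = "length vs"
  obtain v where v: "v \<in> carrier_vec ?n" "v \<noteq> 0\<^sub>v ?n"
    and eig: "\<And>i. i < ?n \<Longrightarrow>
      (\<Sum>j<?n. complex_of_real (laplacian_mat X vs $$ (i, j)) * v $ j) = l * v $ i"
    using complex_spectrumE[OF l(1) laplacian_mat_carrier] by blast
  have "v $ i = 0" if i: "i < ?n" for i
  proof -
    have const: "v $ j = v $ i" if "j < ?n" for j
      using normal_laplacian_eigenvector_constant[OF X conn vs N eig _ that i] neg by simp
    have "l * v $ i = (\<Sum>j<?n. complex_of_real (laplacian_mat X vs $$ (i, j)) * v $ i)"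
      using eig[OF i] const by simp
    also have "\<dots> = of_real (\<Sum>j<?n. laplacian_mat X vs $$ (i, j)) * v $ i"
      by (simp add: sum_distrib_right)
    also have "\<dots> = 0" by (simp add: laplacian_mat_row_sum[OF X vs i])
    finally show ?thesis using l(2) by simp
  qed
  then have "v = 0\<^sub>v ?n" using v(1) by (intro eq_vecI) auto
  with v(2) show False by simp
qed

text \<open>A kernel vector is constant, and a constant vector with zero sum is 0.\<close>

lemma normal_laplacian_kernel:
  assumes X: "digraph X" and conn: "Digraph_Component.connected X"
    and vs: "set vs = verts X" "distinct vs"
    and N: "normal_mat (laplacian_mat X vs)"
    and v: "v \<in> carrier_vec (length vs)" "v \<noteq> 0\<^sub>v (length vs)" "(\<Sum>j<length vs. v $ j) = 0"
    and eig: "\<And>i. i < length vs \<Longrightarrow>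
      (\<Sum>j<length vs. complex_of_real (laplacian_mat X vs $$ (i, j)) * v $ j) = l * v $ i"
  shows "l \<noteq> 0"
proof
  assume l: "l = 0"
  let ?n = "length vs"
  have "v $ i = 0" if i: "i < ?n" for i
  proof -
    have "v $ j = v $ i" if "j < ?n" for j
      using normal_laplacian_eigenvector_constant[OF X conn vs N eig _ that i] l by simp
    then have "of_nat ?n * v $ i = 0" using v(3) by simp
    then show ?thesis using i by auto
  qed
  then have "v = 0\<^sub>v ?n" using v(1) by (intro eq_vecI) auto
  with v(2) show False by simp
qed

section \<open>Extremality of \<open>\<theta>\<close> under the shift by
  \<open>\<alpha>\<close>\<close>

lemma cmod_add_of_real_squared:
  assumes "Re l \<noteq> 0"
  shows "(cmod (of_real a + l))\<^sup>2 = 2 * Re l * (f_val l + a) + a\<^sup>2"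
proof -
  have "2 * Re l * f_val l = (cmod l)\<^sup>2" using assms by (simp add: f_val_def)
  then have "2 * Re l * (f_val l + a) = (Re l)\<^sup>2 + (Im l)\<^sup>2 + 2 * Re l * a"
    by (simp add: distrib_left cmod_power2)
  then show ?thesis unfolding cmod_power2 by (simp add: power2_eq_square algebra_simps)
qed

text \<open>The inequality for \<open>t\<close> is a genuine constraint only if
  \<open>Re l < Re \<theta>\<close>, where it reads \<open>t \<le> g_val \<theta> l\<close>.
  Otherwise its left side is at most 0 and its right side at least 0, since \<open>t \<ge> 0\<close>
  and \<open>\<theta>\<close> maximizes \<open>f_val\<close>.\<close>

lemma alpha_properties:
  assumes pos: "\<And>l. l \<in> S \<Longrightarrow> l \<noteq> 0 \<Longrightarrow> Re l > 0"
    and \<theta>: "is_arg_max f_val (\<lambda>l. l \<in> S - {0}) \<theta>"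
    and \<nu>: "is_arg_min f_val (\<lambda>l. l \<in> S - {0}) \<nu>"
    and \<mu>: "g_minimizer S \<theta> \<mu>"
  shows alpha_neg: "alpha S \<theta> \<nu> \<mu> < 0"
    and alpha_extremal: "\<And>l. l \<in> S \<Longrightarrow> l \<noteq> 0 \<Longrightarrow>
      cmod (of_real (alpha S \<theta> \<nu> \<mu>) + l) \<le> cmod (of_real (alpha S \<theta> \<nu> \<mu>) + \<theta>)"
proof -
  have \<theta>S: "\<theta> \<in> S" "\<theta> \<noteq> 0" and fmax: "\<And>l. l \<in> S \<Longrightarrow> l \<noteq> 0 \<Longrightarrow> f_val l \<le> f_val \<theta>"
    using \<theta> by (auto simp: is_arg_max_def not_less)
  have \<nu>S: "\<nu> \<in> S" "\<nu> \<noteq> 0" using \<nu> by (auto simp: is_arg_min_def)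
  have fpos: "f_val l > 0" if "l \<in> S" "l \<noteq> 0" for l
    using pos[OF that] that by (simp add: f_val_def)
  define t where "t = - alpha S \<theta> \<nu> \<mu> - f_val \<theta>"
  have key: "t \<ge> 0 \<and> (\<forall>l \<in> S - {0}. Re l < Re \<theta> \<longrightarrow>
      t * (Re \<theta> - Re l) \<le> Re l * (f_val \<theta> - f_val l))"
  proof (cases "\<forall>l \<in> S - {0, \<theta>}. Re l \<ge> Re \<theta>")
    case True
    then have "t = f_val \<nu>" by (simp add: t_def alpha_def)
    moreover have "\<not> Re l < Re \<theta>" if "l \<in> S - {0}" for l
      using True that by (cases "l = \<theta>") (auto simp: not_less)
    ultimately show ?thesis using fpos[OF \<nu>S] by auto
  next
    case False
    then have t: "t = g_val \<theta> \<mu>" by (auto simp: t_def alpha_def)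
    \<comment> \<open>Nonnegativity of \<open>g_val\<close> is automatic to the left of
      \<open>\<theta>\<close>, so in this case a minimizer exists and the default
      \<open>\<mu> = 0\<close> does not occur.\<close>
    have g: "l \<in> g_dom S \<theta> \<and> g_val \<theta> l \<ge> 0" if "l \<in> S - {0}" "Re l < Re \<theta>" for l
      using that fmax[of l] pos[of l] by (auto simp: g_dom_def g_val_def)
    obtain l0 where "l0 \<in> S - {0, \<theta>}" "Re l0 < Re \<theta>" using False by (auto simp: not_le)
    then have "\<exists>l \<in> g_dom S \<theta>. g_val \<theta> l \<ge> 0" using g[of l0] by auto
    then have min: "is_arg_min (g_val \<theta>) (\<lambda>l. l \<in> g_dom S \<theta> \<and> g_val \<theta> l \<ge> 0) \<mu>"
      using \<mu> by (simp add: g_minimizer_def)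
    have "t * (Re \<theta> - Re l) \<le> Re l * (f_val \<theta> - f_val l)"
      if l: "l \<in> S - {0}" "Re l < Re \<theta>" for l
    proof -
      have "t \<le> g_val \<theta> l" using min g[OF l] t by (auto simp: is_arg_min_def not_less)
      also have "\<dots> = Re l * (f_val \<theta> - f_val l) / (Re \<theta> - Re l)" using l by (simp add: g_val_def)
      finally show ?thesis using l by (simp add: pos_le_divide_eq)
    qed
    moreover have "t \<ge> 0" using min t by (simp add: is_arg_min_def)
    ultimately show ?thesis by blast
  qed
  have \<alpha>: "alpha S \<theta> \<nu> \<mu> = - f_val \<theta> - t" by (simp add: t_def)
  show "alpha S \<theta> \<nu> \<mu> < 0" using \<alpha> key fpos[OF \<theta>S] by linarith
  fix l assume l: "l \<in> S" "l \<noteq> 0"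
  have "t * (Re \<theta> - Re l) \<le> Re l * (f_val \<theta> - f_val l)"
  proof (cases "Re l < Re \<theta>")
    case True
    then show ?thesis using key l by blast
  next
    case False
    then have "t * (Re \<theta> - Re l) \<le> 0" using key by (simp add: mult_nonneg_nonpos)
    also have "0 \<le> Re l * (f_val \<theta> - f_val l)" using fmax[OF l] pos[OF l] by simp
    finally show ?thesis .
  qed
  \<comment> \<open>Both sides are squared moduli after the shift, less the common term
    \<open>\<alpha>\<^sup>2\<close>.\<close>
  then have "2 * Re l * (f_val l + (- f_val \<theta> - t)) \<le> 2 * Re \<theta> * (f_val \<theta> + (- f_val \<theta> - t))"
    by (simp add: algebra_simps)
  then have "(cmod (of_real (alpha S \<theta> \<nu> \<mu>) + l))\<^sup>2 \<le> (cmod (of_real (alpha S \<theta> \<nu> \<mu>) + \<theta>))\<^sup>2"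
    using pos[OF l] pos[OF \<theta>S]
      cmod_add_of_real_squared[of l "- f_val \<theta> - t"] cmod_add_of_real_squared[of \<theta> "- f_val \<theta> - t"]
    unfolding \<alpha> by linarith
  then show "cmod (of_real (alpha S \<theta> \<nu> \<mu>) + l) \<le> cmod (of_real (alpha S \<theta> \<nu> \<mu>) + \<theta>)"
    by (rule power2_le_imp_le) simp
qed

theorem theorem4p3:
  fixes X :: "('a, 'b) pre_digraph" and vs :: "'a list" and n :: nat
    and L :: "real mat" and S :: "complex set"
    and \<theta> \<nu> \<mu> :: complex and \<alpha> :: real and Y Z :: "'a set"
  assumes "digraph X"
    and "Digraph_Component.connected X"
    and "set vs = verts X" and "distinct vs"
    and "n = card (verts X)"
    and "L = laplacian_mat X vs"
    and "normal_mat L"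
    and "S = complex_spectrum L"
    and "is_arg_max f_val (\<lambda>l. l \<in> S - {0}) \<theta>"
    and "is_arg_min f_val (\<lambda>l. l \<in> S - {0}) \<nu>"
    and "g_minimizer S \<theta> \<mu>"
    and "\<alpha> = alpha S \<theta> \<nu> \<mu>"
    and "Y \<subseteq> verts X" and "Z \<subseteq> verts X" and "Y \<inter> Z = {}"
    and "\<not> (\<exists>z \<in> Z. \<exists>y \<in> Y. z \<rightarrow>\<^bsub>X\<^esub> y)"
  shows "(real (card Y) * real (card Z)) / ((real n - real (card Y)) * (real n - real (card Z)))
           \<le> (cmod (complex_of_real \<alpha> + \<theta>))\<^sup>2 / \<alpha>\<^sup>2"
proof -
  note X = assms(1) and conn = assms(2) and vs = assms(3,4)
  have n: "n = length vs" using assms(3-5) distinct_card by metis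
  have L: "L \<in> carrier_mat n n" using assms(6) n laplacian_mat_carrier by metis
  have N: "normal_mat (laplacian_mat X vs)" using assms(6,7) by simp
  have pos: "Re l > 0" if "l \<in> S" "l \<noteq> 0" for l
    using normal_laplacian_Re_pos[OF X conn vs N] that assms(6,8) by simp
  have \<alpha>: "\<alpha> < 0" using alpha_neg[OF pos assms(9-11)] assms(12) by simp
  let ?c = "cmod (complex_of_real \<alpha> + \<theta>)"
  \<comment> \<open>The separation bound concerns index sets, so vertex sets are pulled back to
    positions in \<open>vs\<close>.\<close>
  define I where "I W = {i. i < n \<and> vs ! i \<in> W}" for W
  have card_I: "card (I W) = card W" if W: "W \<subseteq> verts X" for W
  proof -
    have inj: "inj_on ((!) vs) (I W)"
      using vs(2) n by (auto simp: inj_on_def I_def nth_eq_iff_index_eq)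
    have "w \<in> (!) vs ` I W" if "w \<in> W" for w
    proof -
      have "w \<in> set vs" using that W vs(1) by blast
      then obtain i where "i < n" "w = vs ! i" using n by (auto simp: in_set_conv_nth)
      then show ?thesis using that by (auto simp: I_def)
    qed
    then have "(!) vs ` I W = W" by (auto simp: I_def)
    then show ?thesis using card_image[OF inj] by simp
  qed
  have "\<alpha>\<^sup>2 * (real (card (I Y)) * real (card (I Z)))
      \<le> ?c\<^sup>2 * ((real n - real (card (I Y))) * (real n - real (card (I Z))))"
  proof (rule normal_mat_separation_bound[OF L assms(7)])
    show "(\<Sum>j<n. L $$ (i, j)) = 0" if "i < n" for i
      using laplacian_mat_row_sum[OF X vs] that n assms(6) by simp
    show "cmod (complex_of_real \<alpha> + l) \<le> ?c"
      if v: "v \<in> carrier_vec n" "v \<noteq> 0\<^sub>v n" "(\<Sum>j<n. v $ j) = 0"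
        and eig: "\<And>i. i < n \<Longrightarrow> (\<Sum>j<n. complex_of_real (L $$ (i, j)) * v $ j) = l * v $ i"
      for l v
    proof -
      have "l \<in> S" using complex_spectrumI[OF L v(1,2) eig] assms(8) by simp
      moreover have "l \<noteq> 0"
        using normal_laplacian_kernel[OF X conn vs N, of v l] v eig n assms(6) by simp
      ultimately show ?thesis using alpha_extremal[OF pos assms(9-11)] assms(12) by simp
    qed
    show "L $$ (i, j) = 0" if "i \<in> I Z" "j \<in> I Y" for i j
    proof -
      have "i \<noteq> j" "\<not> vs ! i \<rightarrow>\<^bsub>X\<^esub> vs ! j" using that assms(15,16) by (auto simp: I_def)
      then show ?thesis using that n assms(6) by (simp add: I_def laplacian_mat_index)
    qed
  qed (use assms(15) in \<open>auto simp: I_def\<close>)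
  then have le: "\<alpha>\<^sup>2 * (real (card Y) * real (card Z)) \<le> ?c\<^sup>2 * ((real n - real (card Y)) * (real n - real (card Z)))"
    using card_I assms(13,14) by simp
  show ?thesis
  \<comment> \<open>With a zero denominator the quotient is 0 by convention, and the right side is
    nonnegative.\<close>
  proof (cases "(real n - real (card Y)) * (real n - real (card Z)) = 0")
    case True
    then show ?thesis by auto
  next
    case False
    have "finite (verts X)" using vs(1) by (metis List.finite_set)
    then have "card Y \<le> n" "card Z \<le> n" using assms(5,13,14) card_mono by auto
    then have "(real n - real (card Y)) * (real n - real (card Z)) > 0"
      using False by (simp add: zero_less_mult_iff)
    moreover have "\<alpha>\<^sup>2 > 0" using \<alpha> by simp
    ultimately show ?thesis using le by (simp add: divide_le_eq pos_le_divide_eq mult_ac)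
  qed
qed

end
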